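(* There are infinitely many (pairwise non-isomorphic) finite groups $G$ having a subgroup $H$ such that $\psi'_H(G)>1$.
   Context: For a finite group $G$, a subgroup $H$ of $G$ and $x\in G$, the order of $x$ relative to $H$, denoted $o_H(x)$, is the smallest positive integer $m$ such that $x^m\in H$. Put $\psi_H(G)=\sum_{x\in G}o_H(x)$. Let $C_n$ denote the cyclic group of order $n$. For a finite group $G$ and a subgroup $H$ of $G$, define $$\psi'_H(G)=\frac{\psi_H(G)}{\psi_{C_{|H|}}(C_{|G|})},$$ where in the denominator $C_{|H|}$ denotes the unique subgroup of order $|H|$ of the cyclic group $C_{|G|}$. *)

theory Defs
  imports Complex_Main "HOL-Algebra.Elementary_Groups"
begin

definition rel_ord :: "('a, 'b) monoid_scheme \<Rightarrow> 'a set \<Rightarrow> 'a \<Rightarrow> nat" where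
  "rel_ord G H x = (LEAST m. 0 < m \<and> x [^]\<^bsub>G\<^esub> m \<in> H)"

definition psi :: "('a, 'b) monoid_scheme \<Rightarrow> 'a set \<Rightarrow> nat" where
  "psi G H = (\<Sum>x\<in>carrier G. rel_ord G H x)"

(* The description is proper only when 0 < n and m dvd n; then a cyclic group of
   order n has exactly one subgroup of order m. *)
definition cyclic_subgroup :: "nat \<Rightarrow> nat \<Rightarrow> int set" where
  "cyclic_subgroup n m = (THE K. subgroup K (integer_mod_group n) \<and> card K = m)"

definition psi' :: "('a, 'b) monoid_scheme \<Rightarrow> 'a set \<Rightarrow> real" where
  "psi' G H = real (psi G H) /
     real (psi (integer_mod_group (order G)) (cyclic_subgroup (order G) (card H)))"

end

theory Submission
  imports
    Defs "HOL-Algebra.Weak_Morphisms" "HOL-Algebra.Multiplicative_Group" "HOL-Library.Countable"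
    "HOL-Computational_Algebra.Primes"
begin

text \<open>
  One group with \<open>\<psi>'\<^sub>H(G) > 1\<close> already produces infinitely many. If \<open>h : G \<rightarrow> Q\<close> is an
  epimorphism and \<open>K\<close> is a subgroup of \<open>Q\<close>, then \<open>x\<^sup>m\<close> lies in the preimage of \<open>K\<close> iff \<open>h(x)\<^sup>m\<close>
  lies in \<open>K\<close>, so relative orders are the same above and below and the sum \<open>\<psi>\<close> is multiplied by
  the order of the kernel (\<open>psi_preimage\<close>). The normalising denominator, which belongs to a cyclic
  group, is multiplied by the same factor (\<open>psi_cyclic\<close>), because reduction modulo the index
  \<open>d = |G : H|\<close> shows that it equals \<open>|H| \<psi>(C\<^sub>d)\<close>, where \<open>\<psi>(C\<^sub>d)\<close> is the sum of the element
  orders of \<open>C\<^sub>d\<close>. Hence \<open>\<psi>'\<close> takes the same value on \<open>Q\<close> and on all the products \<open>Q \<times> C\<^sub>k\<close>, which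
  have different orders.

  For \<open>Q\<close> one takes the affine group of the field with eight elements, all maps \<open>x \<mapsto> a x + b\<close> with
  \<open>a \<noteq> 0\<close>, and for \<open>H\<close> the stabiliser of \<open>0\<close>, cyclic of order 7 and index 8. Every element of \<open>Q\<close>
  other than the identity has prime order: the 7 nontrivial translations have order 2, and an element
  that is no translation has order 7, because its seventh power is a translation commuting with it
  and must be trivial (\<open>agl8_nontranslation_pow_7\<close>). An element outside \<open>H\<close> of
  prime order \<open>p\<close> has relative order \<open>p\<close> (\<open>rel_ord_prime\<close>). So the 7 elements of \<open>H\<close> contribute 1
  each, the nontrivial translations 2 each and the remaining 42 elements 7 each, which gives
  \<open>\<psi>\<^sub>H(Q) = 7 + 14 + 294 = 315\<close>. On the cyclic side \<open>\<psi>(C\<^sub>8) = 1 + 2 + 2 \<sqdot> 4 + 4 \<sqdot> 8 = 43\<close>, and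
  \<open>7 \<sqdot> 43 = 301 < 315\<close>. What makes this work is that 8 is a power of 2, so that \<open>C\<^sub>8\<close> has many elements
  of small order, while \<open>8 - 1\<close> is prime, so that in \<open>Q\<close> all but the few translations and the elements of \<open>H\<close> have
  the large relative order 7.
\<close>

section \<open>Relative orders\<close>

context group
begin

lemma rel_ord_least:
  assumes "subgroup H G" "finite (carrier G)" "x \<in> carrier G"
  shows "0 < rel_ord G H x \<and> x [^] rel_ord G H x \<in> H"
proof -
  have "0 < order G \<and> x [^] order G \<in> H"
    using assms by (simp add: order_gt_0_iff_finite pow_order_eq_1 subgroup.one_closed)
  then show ?thesis
    unfolding rel_ord_def by (rule LeastI)
qed

text \<open>The exponents \<open>m\<close> with \<open>x\<^sup>m \<in> H\<close> are closed under taking remainders of one by another, so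
  the least positive one divides all of them, exactly as for ordinary element orders.\<close>

lemma rel_ord_dvd:
  assumes H: "subgroup H G" and "finite (carrier G)" and x: "x \<in> carrier G"
    and m: "x [^] m \<in> H"
  shows "rel_ord G H x dvd m"
proof -
  define d where "d = rel_ord G H x"
  have d: "0 < d" "x [^] d \<in> H"
    using rel_ord_least[OF assms(1-3)] by (auto simp: d_def)
  have q: "x [^] (d * (m div d)) \<in> H"
    using d(2) subgroup_int_pow_closed[OF H, of "x [^] d" "int (m div d)"] x
    by (simp add: int_pow_int nat_pow_pow)
  have "x [^] m = x [^] (d * (m div d)) \<otimes> x [^] (m mod d)"
    using x by (simp add: nat_pow_mult)
  then have "x [^] (m mod d) = inv (x [^] (d * (m div d))) \<otimes> x [^] m"
    using x by (simp add: inv_solve_left)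
  also have "\<dots> \<in> H"
    using q m H by (simp add: subgroup.m_closed subgroup.m_inv_closed)
  finally have "x [^] (m mod d) \<in> H" .
  then have "\<not> 0 < m mod d"
    using not_less_Least[of "m mod d" "\<lambda>m. 0 < m \<and> x [^] m \<in> H"] d(1)
    by (auto simp: d_def rel_ord_def)
  then show ?thesis
    by (simp add: d_def dvd_eq_mod_eq_0)
qed

lemma rel_ord_prime:
  assumes H: "subgroup H G" and fin: "finite (carrier G)" and x: "x \<in> carrier G" "x \<notin> H"
    and p: "prime p" "x [^] p \<in> H"
  shows "rel_ord G H x = p"
proof -
  have "rel_ord G H x \<noteq> 1"
    using rel_ord_least[OF H fin x(1)] x by auto
  then show ?thesis
    using rel_ord_dvd[OF H fin x(1) p(2)] p(1) by (auto simp: prime_nat_iff)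
qed

lemma rel_ord_mem:
  assumes "x \<in> H" "x \<in> carrier G"
  shows "rel_ord G H x = 1"
  unfolding rel_ord_def by (rule Least_equality) (use assms in auto)

end


section \<open>Pulling back along epimorphisms\<close>

context group_hom
begin

lemma subgroup_preimage:
  assumes "subgroup K H"
  shows "subgroup (h -` K \<inter> carrier G) G"
  using assms by (intro subgroup.intro) (auto simp: subgroup.m_closed subgroup.one_closed subgroup.m_inv_closed)

lemma rel_ord_preimage:
  assumes "x \<in> carrier G"
  shows "rel_ord G (h -` K \<inter> carrier G) x = rel_ord H K (h x)"
  using assms by (simp add: rel_ord_def hom_nat_pow)

text \<open>The fibres of a homomorphism are the cosets of its kernel.\<close>

lemma card_fibre:
  assumes "z \<in> carrier G"
  shows "card {x \<in> carrier G. h x = h z} = card (kernel G H h)"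
proof (rule bij_betw_same_card[symmetric])
  show "bij_betw (\<lambda>k. z \<otimes> k) (kernel G H h) {x \<in> carrier G. h x = h z}"
    by (rule bij_betwI[where g = "\<lambda>x. inv z \<otimes> x"])
       (use assms in \<open>auto simp: kernel_def G.m_assoc[symmetric]\<close>)
qed

text \<open>Both \<open>\<psi>\<close> and cardinalities are sums over a preimage of a function that factors through \<open>h\<close>;
  grouping by fibres handles the two at once.\<close>

lemma sum_over_epimorphism:
  fixes f :: "'c \<Rightarrow> nat"
  assumes fin: "finite (carrier G)" and surj: "h ` carrier G = carrier H" and A: "A \<subseteq> carrier H"
  shows "(\<Sum>x\<in>h -` A \<inter> carrier G. f (h x)) = card (kernel G H h) * (\<Sum>y\<in>A. f y)"
proof -
  have finA: "finite A"
    using finite_subset[OF A] fin surj by (metis finite_imageI)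
  have "(\<Sum>x\<in>h -` A \<inter> carrier G. f (h x))
      = (\<Sum>y\<in>A. \<Sum>x\<in>{x \<in> h -` A \<inter> carrier G. h x = y}. f (h x))"
    using fin finA by (intro sum.group[symmetric]) auto
  also have "\<dots> = (\<Sum>y\<in>A. card (kernel G H h) * f y)"
  proof (rule sum.cong[OF refl])
    fix y assume y: "y \<in> A"
    then obtain z where z: "z \<in> carrier G" "y = h z"
      using A surj by blast
    have "{x \<in> h -` A \<inter> carrier G. h x = y} = {x \<in> carrier G. h x = h z}"
      using y z by auto
    then show "(\<Sum>x\<in>{x \<in> h -` A \<inter> carrier G. h x = y}. f (h x)) = card (kernel G H h) * f y"
      using card_fibre[OF z(1)] z(2) by simp
  qed
  finally show ?thesis
    by (simp add: sum_distrib_left)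
qed

lemma card_preimage:
  assumes "finite (carrier G)" "h ` carrier G = carrier H" "A \<subseteq> carrier H"
  shows "card (h -` A \<inter> carrier G) = card (kernel G H h) * card A"
  using sum_over_epimorphism[OF assms, of "\<lambda>_. 1"] by simp

lemma order_epimorphism:
  assumes "finite (carrier G)" "h ` carrier G = carrier H"
  shows "order G = card (kernel G H h) * order H"
proof -
  have "h -` carrier H \<inter> carrier G = carrier G"
    by auto
  then show ?thesis
    using card_preimage[OF assms subset_refl] by (simp add: order_def)
qed

lemma psi_preimage:
  assumes "finite (carrier G)" "h ` carrier G = carrier H"
  shows "psi G (h -` K \<inter> carrier G) = card (kernel G H h) * psi H K"
proof -
  have "carrier G = h -` carrier H \<inter> carrier G"
    by auto
  then show ?thesis
    using sum_over_epimorphism[OF assms subset_refl, of "rel_ord H K"]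
    by (simp add: psi_def rel_ord_preimage cong: sum.cong)
qed

end


section \<open>Cyclic groups\<close>

text \<open>In a subgroup of order \<open>m\<close> every element is killed by \<open>m\<close>; modulo \<open>d m\<close> this says that it is a
  multiple of \<open>d\<close>, and there are only \<open>m\<close> such residues. This settles uniqueness.\<close>

lemma cyclic_subgroup_eq_multiples:
  assumes "0 < d" "0 < m"
  shows "cyclic_subgroup (d * m) m = {x \<in> {0..<int (d * m)}. int d dvd x}"
proof -
  let ?Z = "integer_mod_group (d * m)" and ?K = "{x \<in> {0..<int (d * m)}. int d dvd x}"
  have carr: "carrier ?Z = {0..<int (d * m)}"
    using assms by (simp add: carrier_integer_mod_group)
  have "?K = (\<lambda>k. int d * k) ` {0..<int m}"
    using assms by (auto simp: zero_le_mult_iff elim!: dvdE)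
  then have card: "card ?K = m"
    using assms by (simp add: card_image inj_on_def)
  have sub: "subgroup ?K ?Z"
  proof (rule group.subgroupI)
    fix x assume "x \<in> ?K"
    then show "inv\<^bsub>?Z\<^esub> x \<in> ?K"
      using assms by (simp add: carr dvd_mod)
  next
    fix x y assume "x \<in> ?K" "y \<in> ?K"
    then show "x \<otimes>\<^bsub>?Z\<^esub> y \<in> ?K"
      using assms by (simp add: dvd_mod)
  qed (use assms in \<open>auto simp: carr intro!: exI[of _ 0]\<close>)
  have uniq: "L = ?K" if L: "subgroup L ?Z" "card L = m" for L
  proof (rule card_subset_eq)
    show "L \<subseteq> ?K"
    proof
      fix x assume x: "x \<in> L"
      have xZ: "x \<in> {0..<int (d * m)}"
        using subgroup.subset[OF L(1)] x carr by auto
      \<comment> \<open>Lagrange's theorem in \<open>L\<close> itself, whose powers agree with those of the ambient group.\<close>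
      interpret L: group "?Z\<lparr>carrier := L\<rparr>"
        using L(1) by (intro subgroup.subgroup_is_group) auto
      have "x [^]\<^bsub>?Z\<lparr>carrier := L\<rparr>\<^esub> order (?Z\<lparr>carrier := L\<rparr>) = \<one>\<^bsub>?Z\<lparr>carrier := L\<rparr>\<^esub>"
        using x by (intro L.pow_order_eq_1) auto
      then have "x [^]\<^bsub>?Z\<^esub> m = 0"
        using L(2) by (simp add: order_def nat_pow_def)
      then have "int (d * m) dvd int m * x"
        by (simp add: dvd_eq_mod_eq_0)
      then have "int d dvd x"
        using assms by (simp add: mult.commute)
      with xZ show "x \<in> ?K" by simp
    qed
    show "finite ?K"
      by (rule finite_subset[of _ "{0..<int (d * m)}"]) auto
  qed (use card L(2) in auto)
  show ?thesis
    unfolding cyclic_subgroup_def by (rule the_equality, rule conjI[OF sub card], use uniq in blast)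
qed

text \<open>The subgroup of order \<open>m\<close> is the preimage of the trivial subgroup under reduction modulo \<open>d\<close>,
  so the pullback formula applies.\<close>

lemma psi_cyclic:
  assumes "0 < d" "0 < m"
  shows "psi (integer_mod_group (d * m)) (cyclic_subgroup (d * m) m)
       = m * psi (integer_mod_group d) {0}"
proof -
  let ?Z = "integer_mod_group (d * m)" and ?f = "\<lambda>x. x mod int d"
  have dm: "(x mod (int d * int m)) mod int d = x mod int d" for x
    by (simp add: mod_mod_cancel)
  have carr: "carrier ?Z = {0..<int (d * m)}" "carrier (integer_mod_group d) = {0..<int d}"
    using assms by (simp_all add: carrier_integer_mod_group)
  interpret f: group_hom ?Z "integer_mod_group d" ?f
    by (intro group_hom.intro group_hom_axioms.intro)
       (use assms in \<open>auto simp: hom_def carr dm mod_simps\<close>)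
  have surj: "?f ` carrier ?Z = carrier (integer_mod_group d)"
  proof
    show "carrier (integer_mod_group d) \<subseteq> ?f ` carrier ?Z"
    proof
      fix x assume "x \<in> carrier (integer_mod_group d)"
      moreover have "int d * 1 \<le> int d * int m"
        using assms by (intro mult_left_mono) auto
      then have "x < int d * int m" if "x < int d"
        using that by linarith
      ultimately show "x \<in> ?f ` carrier ?Z"
        by (intro image_eqI[of _ _ x]) (auto simp: carr)
    qed
  qed (use assms in \<open>auto simp: carr\<close>)
  have pre: "?f -` {0} \<inter> carrier ?Z = cyclic_subgroup (d * m) m"
    using assms by (auto simp: carr cyclic_subgroup_eq_multiples dvd_eq_mod_eq_0)
  have "kernel ?Z (integer_mod_group d) ?f = cyclic_subgroup (d * m) m"
    unfolding pre[symmetric] by (auto simp: kernel_def)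
  moreover have "card (cyclic_subgroup (d * m) m) = m"
    using f.order_epimorphism[OF _ surj] assms calculation
    by (simp add: order_def carr nat_mult_distrib)
  ultimately show ?thesis
    using f.psi_preimage[OF _ surj, of "{0}", unfolded pre] by (simp add: carr)
qed

lemma psi'_eq:
  assumes "0 < d" "0 < m" "order G = d * m" "card H = m"
  shows "psi' G H = real (psi G H) / (real m * real (psi (integer_mod_group d) {0}))"
  using psi_cyclic[OF assms(1,2)] by (simp add: psi'_def assms(3,4))

lemma psi_cyclic_8: "psi (integer_mod_group 8) {0} = 43"
proof -
  let ?r = "rel_ord (integer_mod_group 8) {0}"
  have *: "?r x = d" if "0 < d" "8 dvd int d * x" "\<And>k. 0 < k \<Longrightarrow> 8 dvd int k * x \<Longrightarrow> d \<le> k" for x d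
    unfolding rel_ord_def by (rule Least_equality) (use that in \<open>auto simp: dvd_eq_mod_eq_0\<close>)
  have "?r 0 = 1" "?r 1 = 8" "?r 2 = 4" "?r 3 = 8" "?r 4 = 2" "?r 5 = 8" "?r 6 = 4" "?r 7 = 8"
    by (rule *; presburger)+
  moreover have "{0..<8::int} = {0,1,2,3,4,5,6,7}"
    by auto
  ultimately show ?thesis
    by (simp add: psi_def carrier_integer_mod_group)
qed


section \<open>The affine group of the field with eight elements\<close>

text \<open>The triple \<open>(a, b, c)\<close> stands for \<open>a + b t + c t\<^sup>2\<close> in \<open>GF(2)[t] / (t\<^sup>3 + t + 1)\<close>.\<close>

type_synonym f8 = "bool \<times> bool \<times> bool"

fun f8_add :: "f8 \<Rightarrow> f8 \<Rightarrow> f8" where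
  "f8_add (a, b, c) (a', b', c') = (a \<noteq> a', b \<noteq> b', c \<noteq> c')"

text \<open>This is multiplication by \<open>t\<close>, which generates the multiplicative group of order 7; no other
  product of the field is needed, since multiplication by any nonzero element is an iterate.\<close>

fun f8_gen :: "f8 \<Rightarrow> f8" where
  "f8_gen (a, b, c) = (c, a \<noteq> c, b)"

abbreviation f8_zero :: f8 where
  "f8_zero \<equiv> (False, False, False)"

lemma card_f8: "card (UNIV :: f8 set) = 8"
  by (simp add: card_cartesian_product flip: UNIV_Times_UNIV)

text \<open>The pair \<open>(u, i)\<close> stands for the affine map \<open>x \<mapsto> t\<^sup>i x + u\<close>.\<close>

definition agl8 :: "(f8 \<times> nat) monoid" where
  "agl8 = \<lparr>carrier = UNIV \<times> {..<7},
           monoid.mult = (\<lambda>(u, i) (v, j). (f8_add u ((f8_gen ^^ i) v), (i + j) mod 7)),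
           one = (f8_zero, 0)\<rparr>"

definition agl8_stabilizer :: "(f8 \<times> nat) set" where
  "agl8_stabilizer = {f8_zero} \<times> {..<7}"

lemma f8_add_simps:
  "f8_add (f8_add u v) w = f8_add u (f8_add v w)"
  "f8_add f8_zero u = u" "f8_add u f8_zero = u" "f8_add u u = f8_zero"
  by (cases u; cases v; cases w; auto)+

lemma f8_gen_funpow_add:
  "(f8_gen ^^ i) (f8_add u v) = f8_add ((f8_gen ^^ i) u) ((f8_gen ^^ i) v)"
proof (induction i)
  case (Suc i)
  have "f8_gen (f8_add a b) = f8_add (f8_gen a) (f8_gen b)" for a b
    by (cases a; cases b) auto
  with Suc show ?case by simp
qed simp

lemma f8_gen_funpow_zero: "(f8_gen ^^ i) f8_zero = f8_zero"
  by (induction i) auto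

lemma f8_gen_funpow_mod: "(f8_gen ^^ (i mod 7)) u = (f8_gen ^^ i) u"
proof (rule funpow_mod_eq)
  show "(f8_gen ^^ 7) u = u"
    by (cases u) (auto simp: numeral_eq_Suc)
qed

lemma group_agl8: "group agl8"
proof (rule groupI)
  fix x y z assume "x \<in> carrier agl8" "y \<in> carrier agl8" "z \<in> carrier agl8"
  then show "x \<otimes>\<^bsub>agl8\<^esub> y \<otimes>\<^bsub>agl8\<^esub> z = x \<otimes>\<^bsub>agl8\<^esub> (y \<otimes>\<^bsub>agl8\<^esub> z)"
    by (auto simp: agl8_def f8_gen_funpow_mod f8_add_simps(1) f8_gen_funpow_add funpow_add
        mod_simps add.assoc simp del: f8_add.simps split: prod.splits)
next
  fix x assume "x \<in> carrier agl8"
  then obtain u i where x: "x = (u, i)" "i < 7"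
    by (auto simp: agl8_def)
  \<comment> \<open>The inverse of \<open>y \<mapsto> t\<^sup>i y + u\<close> is \<open>y \<mapsto> t\<^sup>-\<^sup>i y + t\<^sup>-\<^sup>i u\<close> in characteristic 2; the reduction
    of \<open>7 - i\<close> matters for \<open>i = 0\<close>.\<close>
  have "((f8_gen ^^ (7 - i)) u, (7 - i) mod 7) \<otimes>\<^bsub>agl8\<^esub> x = \<one>\<^bsub>agl8\<^esub>"
    using x(2) unfolding x(1)
    by (simp add: agl8_def f8_gen_funpow_mod f8_add_simps mod_simps)
  moreover have "((f8_gen ^^ (7 - i)) u, (7 - i) mod 7) \<in> carrier agl8"
    by (simp add: agl8_def)
  ultimately show "\<exists>y\<in>carrier agl8. y \<otimes>\<^bsub>agl8\<^esub> x = \<one>\<^bsub>agl8\<^esub>" by blast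
qed (auto simp: agl8_def f8_add_simps split: prod.splits)

lemma subgroup_agl8_stabilizer: "subgroup agl8_stabilizer agl8"
proof -
  interpret group agl8 by (rule group_agl8)
  have inv: "inv\<^bsub>agl8\<^esub> (f8_zero, i) = (f8_zero, (7 - i) mod 7)" if "i < 7" for i
    by (rule inv_equality) (use that in \<open>auto simp: agl8_def f8_gen_funpow_zero mod_simps\<close>)
  show ?thesis
  proof (rule subgroupI)
    have "(f8_zero, 0) \<in> agl8_stabilizer"
      by (simp add: agl8_stabilizer_def)
    then show "agl8_stabilizer \<noteq> {}"
      by blast
    show "agl8_stabilizer \<subseteq> carrier agl8"
      by (auto simp: agl8_stabilizer_def agl8_def)
  next
    fix x assume "x \<in> agl8_stabilizer"
    then show "inv\<^bsub>agl8\<^esub> x \<in> agl8_stabilizer"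
      by (auto simp: agl8_stabilizer_def inv)
  next
    fix x y assume "x \<in> agl8_stabilizer" "y \<in> agl8_stabilizer"
    then show "x \<otimes>\<^bsub>agl8\<^esub> y \<in> agl8_stabilizer"
      by (auto simp: agl8_stabilizer_def agl8_def f8_gen_funpow_zero)
  qed
qed

lemma agl8_translation_square:
  "(u, 0) [^]\<^bsub>agl8\<^esub> (2::nat) = \<one>\<^bsub>agl8\<^esub>"
  by (simp add: agl8_def nat_pow_def numeral_2_eq_2 f8_add_simps)

text \<open>In the field, \<open>(t\<^sup>i - 1) w = 0\<close> forces \<open>w = 0\<close> unless \<open>t\<^sup>i = 1\<close>.\<close>

lemma f8_gen_fixpoint_free:
  assumes "0 < i" "i < 7" "(f8_gen ^^ i) w = w"
  shows "w = f8_zero"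
proof -
  obtain a b c where w: "w = (a, b, c)"
    by (cases w)
  have "i \<in> {1, 2, 3, 4, 5, 6}"
    using assms(1,2) by auto
  then show ?thesis
    using assms(3) unfolding w by (elim insertE emptyE) (auto simp: numeral_eq_Suc)
qed

text \<open>The seventh power of \<open>x = (u, i)\<close> is a translation that commutes with \<open>x\<close>. Commuting with \<open>x\<close>
  means that its translation vector is fixed by multiplication by \<open>t\<^sup>i\<close>, hence is zero.\<close>

lemma agl8_nontranslation_pow_7:
  assumes "0 < i" "i < 7"
  shows "(u, i) [^]\<^bsub>agl8\<^esub> (7::nat) = \<one>\<^bsub>agl8\<^esub>"
proof -
  interpret group agl8 by (rule group_agl8)
  let ?x = "(u, i)"
  have x: "?x \<in> carrier agl8"
    using assms by (simp add: agl8_def)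
  have "snd (?x [^]\<^bsub>agl8\<^esub> n) = n * i mod 7" for n :: nat
    by (induction n) (auto simp: agl8_def mod_simps add.commute split: prod.splits)
  from this[of 7] obtain w where w: "?x [^]\<^bsub>agl8\<^esub> (7::nat) = (w, 0)"
    by (cases "?x [^]\<^bsub>agl8\<^esub> (7::nat)") auto
  have "(w, 0) \<otimes>\<^bsub>agl8\<^esub> ?x = ?x \<otimes>\<^bsub>agl8\<^esub> (w, 0)"
    unfolding w[symmetric] using x by (simp add: nat_pow_comm[of ?x 7 1, simplified])
  then have "f8_add w u = f8_add u ((f8_gen ^^ i) w)"
    by (simp add: agl8_def)
  then have "(f8_gen ^^ i) w = w"
    by (cases w; cases u; cases "(f8_gen ^^ i) w") auto
  then show ?thesis
    using f8_gen_fixpoint_free[OF assms] w by (simp add: agl8_def)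
qed

lemma psi_agl8: "psi agl8 agl8_stabilizer = 315"
proof -
  interpret group agl8 by (rule group_agl8)
  have fin: "finite (carrier agl8)" by (simp add: agl8_def)
  let ?H = agl8_stabilizer
  \<comment> \<open>\<open>T\<close> holds the nontrivial translations, \<open>R\<close> the other maps that move \<open>0\<close>.\<close>
  define T where "T = (UNIV - {f8_zero}) \<times> {0::nat}"
  define R where "R = (UNIV - {f8_zero}) \<times> {1..<7::nat}"
  have carr: "carrier agl8 = ?H \<union> (T \<union> R)" and disj: "?H \<inter> (T \<union> R) = {}" "T \<inter> R = {}"
    by (auto simp: agl8_def agl8_stabilizer_def T_def R_def)
  have fins: "finite ?H" "finite T" "finite R"
    by (auto simp: agl8_stabilizer_def T_def R_def)
  have cards: "card ?H = 7" "card T = 7" "card R = 42"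
    by (simp_all add: agl8_stabilizer_def T_def R_def card_cartesian_product card_f8 card_Diff_subset)
  have one: "\<one>\<^bsub>agl8\<^esub> \<in> ?H"
    by (rule subgroup.one_closed[OF subgroup_agl8_stabilizer])
  have rH: "rel_ord agl8 ?H x = 1" if "x \<in> ?H" for x
    using that carr by (intro rel_ord_mem) auto
  have rel_ord_outside: "rel_ord agl8 ?H x = p"
    if "x \<in> T \<union> R" "prime p" "x [^]\<^bsub>agl8\<^esub> p = \<one>\<^bsub>agl8\<^esub>" for x p
  proof (rule rel_ord_prime[OF subgroup_agl8_stabilizer fin])
    show "x \<in> carrier agl8" "x \<notin> ?H"
      using that(1) carr disj by blast+
  qed (use that one in simp_all)
  have rT: "rel_ord agl8 ?H x = 2" if x: "x \<in> T" for x
  proof -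
    obtain u where "x = (u, 0)"
      using x unfolding T_def by (elim SigmaE) simp
    then show ?thesis
      using x by (intro rel_ord_outside) (simp_all add: agl8_translation_square)
  qed
  have "prime (7::nat)"
    by (simp add: prime_nat_numeral_eq)
  then have rR: "rel_ord agl8 ?H x = 7" if x: "x \<in> R" for x
  proof -
    obtain u i where "x = (u, i)" "0 < i" "i < 7"
      using x unfolding R_def by auto
    then show ?thesis
      using x \<open>prime 7\<close> by (intro rel_ord_outside) (simp_all add: agl8_nontranslation_pow_7)
  qed
  show ?thesis
    unfolding psi_def carr
    using fins disj by (simp add: sum.union_disjoint rH rT rR cards)
qed


section \<open>Infinitely many groups\<close>

lemma (in group) iso_image_group:
  assumes "inj_on f (carrier G)"
  shows "f \<in> iso G (image_group f G)"
  using assms by (auto simp: iso_def hom_def bij_betw_def image_group_def)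

lemma (in group) group_image_group:
  assumes "inj_on f (carrier G)"
  shows "group (image_group f G)"
  using iso_imp_img_group[OF iso_image_group[OF assms]] by (simp add: image_group_def)

text \<open>Direct products with different cyclic groups are carried over to natural numbers along an
  injection, so that the whole family consists of groups over one base type.\<close>

definition agl8_times_cyclic :: "nat \<Rightarrow> nat monoid" where
  "agl8_times_cyclic k = image_group to_nat (agl8 \<times>\<times> integer_mod_group k)"

text \<open>The subgroup is the preimage of the stabiliser under the projection to the affine group. Its
  index is again 8, so both \<open>\<psi>\<close> and the denominator grow by the factor \<open>k\<close>, and the ratio stays
  \<open>315 / 301\<close>.\<close>

lemma agl8_times_cyclic:
  assumes "0 < k"
  shows "group (agl8_times_cyclic k)" "order (agl8_times_cyclic k) = 56 * k"
    "\<exists>H. subgroup H (agl8_times_cyclic k) \<and> psi' (agl8_times_cyclic k) H > 1"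
proof -
  let ?P = "agl8 \<times>\<times> integer_mod_group k" and ?G = "agl8_times_cyclic k"
  interpret P: group ?P by (intro DirProd_group group_agl8 group_integer_mod_group)
  have iso: "to_nat \<in> iso ?P ?G" and grp: "group ?G"
    unfolding agl8_times_cyclic_def by (auto intro!: P.iso_image_group P.group_image_group)
  show "group ?G" by fact
  have card: "order ?G = 56 * k"
    using assms iso_same_card[OF is_isoI[OF iso]]
    by (simp add: order_def card_cartesian_product card_f8 agl8_def carrier_integer_mod_group)
  then show "order ?G = 56 * k" .
  have fin: "finite (carrier ?G)"
    using card assms by (intro card_ge_0_finite) (simp add: order_def)
  define h where "h = fst \<circ> inv_into (carrier ?P) to_nat"
  have inv: "inv_into (carrier ?P) to_nat \<in> iso ?G ?P"
    by (rule P.iso_set_sym[OF iso])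
  interpret h: group_hom ?G agl8 h
    unfolding h_def
    by (intro group_hom.intro group_hom_axioms.intro grp group_agl8
        Group.hom_compose[where H = ?P])
       (use inv in \<open>auto simp: iso_def hom_def DirProd_def\<close>)
  have surj: "h ` carrier ?G = carrier agl8"
  proof -
    have "inv_into (carrier ?P) to_nat ` carrier ?G = carrier ?P"
      using inv by (simp add: iso_def bij_betw_def)
    then have "h ` carrier ?G = fst ` carrier ?P"
      by (simp only: h_def image_comp[symmetric])
    then show ?thesis using assms by (simp add: carrier_integer_mod_group)
  qed
  have ker: "card (kernel ?G agl8 h) = k"
    using h.order_epimorphism[OF fin surj] card
    by (simp add: order_def agl8_def card_cartesian_product card_f8)
  let ?H = "h -` agl8_stabilizer \<inter> carrier ?G"
  have "card ?H = 7 * k"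
    using h.card_preimage[OF fin surj subgroup.subset[OF subgroup_agl8_stabilizer]] ker
    by (simp add: agl8_stabilizer_def card_cartesian_product)
  moreover have "psi ?G ?H = k * 315"
    using h.psi_preimage[OF fin surj] ker by (simp add: psi_agl8)
  ultimately have "psi' ?G ?H = 315 / 301"
    using psi'_eq[of 8 "7 * k" ?G ?H] assms card by (simp add: psi_cyclic_8 field_simps)
  then show "\<exists>H. subgroup H ?G \<and> psi' ?G H > 1"
    using h.subgroup_preimage[OF subgroup_agl8_stabilizer] by (intro exI[of _ ?H]) simp
qed

theorem theorem1p3:
  shows "\<exists>\<G> :: nat monoid set. infinite \<G> \<and>
           (\<forall>G\<in>\<G>. group G \<and> finite (carrier G) \<and> (\<exists>H. subgroup H G \<and> psi' G H > 1)) \<and>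
           (\<forall>G\<in>\<G>. \<forall>K\<in>\<G>. G \<noteq> K \<longrightarrow> \<not> G \<cong> K)"
proof (intro exI[of _ "agl8_times_cyclic ` {0<..}"] conjI ballI impI)
  have order: "card (carrier (agl8_times_cyclic k)) = 56 * k" if "0 < k" for k
    using agl8_times_cyclic(2)[OF that] by (simp add: order_def)
  have "inj_on agl8_times_cyclic {0<..}"
  proof (rule inj_onI)
    fix k l assume "k \<in> {0<..}" "l \<in> {0<..}" "agl8_times_cyclic k = agl8_times_cyclic l"
    then show "k = l"
      by (metis greaterThan_iff mult_cancel1 order zero_neq_numeral)
  qed
  then show "infinite (agl8_times_cyclic ` {0<..})"
    by (simp add: finite_image_iff infinite_Ioi)
  fix G assume "G \<in> agl8_times_cyclic ` {0<..}"
  then obtain k where k: "G = agl8_times_cyclic k" "0 < k" by auto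
  then show "group G" "\<exists>H. subgroup H G \<and> psi' G H > 1"
    by (auto intro: agl8_times_cyclic)
  show "finite (carrier G)"
    using order k by (intro card_ge_0_finite) simp
  fix K assume "K \<in> agl8_times_cyclic ` {0<..}"
  then obtain l where l: "K = agl8_times_cyclic l" "0 < l" by auto
  assume "G \<noteq> K"
  then have "card (carrier G) \<noteq> card (carrier K)"
    using k l order by auto
  then show "\<not> G \<cong> K"
    using iso_same_card by blast
qed

end
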